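(* Let $A=(c_{ij}x^{\alpha_{ij}})$ be an $s\times l$ multigraded squarefree matrix of uniform rank over $R=\Bbbk[x_1,\ldots,x_n]$, with $l\ge s$. For $i\in[s]$ let $$I_i=\langle\ \mathrm{lcm}(x^{\alpha_{ij_1}},\ldots,x^{\alpha_{ij_{s-i+1}}})\ :\ 1\le j_1<\cdots<j_{s-i+1}\le l\ \rangle .$$ Then $$\mathrm{ann}(M_A)=I_1\cap\cdots\cap I_s .$$
   Context: $\Bbbk$ is a field of characteristic $0$, $R=\Bbbk[x_1,\ldots,x_n]$, $[t]=\{1,\ldots,t\}$, $x^\alpha=x_1^{a_1}\cdots x_n^{a_n}$ for $\alpha=(a_1,\dots,a_n)$. An $s\times l$ matrix $A=(c_{ij}x^{\alpha_{ij}})$ with $c_{ij}\in\Bbbk$, $\alpha_{ij}\in\mathbb N^n$ is multigraded if every minor of $A$ equals $c\,x^{\alpha}$ for some $c\in\Bbbk$ (possibly $0$) and some $\alpha\in\mathbb N^n$. It is of uniform rank if all of its minors (of all sizes) are nonzero. The system $E_A$ consists of the equations $\gamma_j-\beta_i=\alpha_{ij}$, one for each $(i,j)$ with $c_{ij}\ne0$, in the unknown vectors $\gamma_1,\ldots,\gamma_l,\beta_1,\ldots,\beta_s$. A multigraded matrix $A$ is squarefree if $E_A$ has a solution with all $\gamma_j,\beta_i\in\{0,1\}^n$. $M_A$ is the cokernel of the $R$-linear map $\phi:F_1\to F_0$, where $F_1$, $F_0$ are free with bases $\{w_j:j\in[l]\}$ and $\{v_i:i\in[s]\}$ and $\phi(w_j)=\sum_i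 c_{ij}x^{\alpha_{ij}}v_i$ (graded by means of a solution of $E_A$). *)

theory Defs
  imports
    "HOL-Library.Poly_Mapping"
    "HOL-Algebra.AbelCoset"
    "HOL-Algebra.Ideal"
    "HOL-Algebra.Algebraic_Closure_Type"
    "Jordan_Normal_Form.Determinant"
    "Jordan_Normal_Form.DL_Submatrix"
begin

section \<open>Polynomials, monomials and least common multiples\<close>

text \<open>
  The variables are the elements of a finite type \<open>'n\<close>, so that
  \<open>n = CARD('n)\<close>; an exponent vector in $\mathbb{N}^n$ is an element of
  \<open>'n \<Rightarrow>\<^sub>0 nat\<close>, and \<open>Poly_Mapping.single \<alpha> c\<close> is the term $c\,x^\alpha$.
\<close>

type_synonym 'n expo = "'n \<Rightarrow>\<^sub>0 nat"
type_synonym ('n, 'k) mpoly = "('n \<Rightarrow>\<^sub>0 nat) \<Rightarrow>\<^sub>0 'k"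

abbreviation monomial :: "'n expo \<Rightarrow> ('n, 'k::zero_neq_one) mpoly" where
  "monomial \<alpha> \<equiv> Poly_Mapping.single \<alpha> 1"

text \<open>
  The exponent of the least common multiple of the monomials with exponents in the finite
  nonempty set \<open>S\<close>; the lemmas below show that it is the lcm with respect to
  divisibility in the polynomial ring.
\<close>

definition lcm_expo :: "('n::finite) expo set \<Rightarrow> 'n expo" where
  "lcm_expo S = Abs_poly_mapping (\<lambda>k. MAX \<alpha>\<in>S. Poly_Mapping.lookup \<alpha> k)"

lemma lookup_lcm_expo:
  fixes S :: "('n::finite) expo set"
  shows "Poly_Mapping.lookup (lcm_expo S) k = (MAX \<alpha>\<in>S. Poly_Mapping.lookup \<alpha> k)"
  unfolding lcm_expo_def by (subst Abs_poly_mapping_inverse) simp_all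

lemma lookup_monomial_mult:
  fixes q :: "('n, 'k::comm_ring_1) mpoly"
  shows "Poly_Mapping.lookup (monomial \<alpha> * q) (\<alpha> + \<beta>) = Poly_Mapping.lookup q \<beta>"
proof (induction q rule: update_induct)
  case const
  then show ?case by simp
next
  case (update f a b)
  have eq: "Poly_Mapping.update a b f = Poly_Mapping.single a b + f"
    by (rule poly_mapping_eqI)
      (use update(1) in \<open>auto simp: lookup_update lookup_add lookup_single when_def in_keys_iff\<close>)
  show ?case
    unfolding eq distrib_left lookup_add mult_single
    using update by (simp add: lookup_single when_def)
qed

lemma sum_single_lookup:
  "(\<Sum>\<beta>\<in>Poly_Mapping.keys p. Poly_Mapping.single \<beta> (Poly_Mapping.lookup p \<beta>)) = p"
  by (rule poly_mapping_eqI) (simp add: lookup_sum lookup_single when_def in_keys_iff)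

lemma monomial_dvd_iff:
  fixes p :: "('n, 'k::comm_ring_1) mpoly"
  shows "monomial \<alpha> dvd p \<longleftrightarrow>
    (\<forall>\<beta>\<in>Poly_Mapping.keys p. \<forall>k. Poly_Mapping.lookup \<alpha> k \<le> Poly_Mapping.lookup \<beta> k)"
proof
  assume "monomial \<alpha> dvd p"
  then obtain q where p: "p = monomial \<alpha> * q" by (elim dvdE)
  show "\<forall>\<beta>\<in>Poly_Mapping.keys p. \<forall>k. Poly_Mapping.lookup \<alpha> k \<le> Poly_Mapping.lookup \<beta> k"
  proof (intro ballI allI)
    fix \<beta> k assume "\<beta> \<in> Poly_Mapping.keys p"
    then obtain \<delta> where "\<beta> = \<alpha> + \<delta>"
      unfolding p using keys_mult[of "monomial \<alpha>" q] by (auto split: if_splits)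
    then show "Poly_Mapping.lookup \<alpha> k \<le> Poly_Mapping.lookup \<beta> k"
      by (simp add: lookup_add)
  qed
next
  assume le: "\<forall>\<beta>\<in>Poly_Mapping.keys p. \<forall>k. Poly_Mapping.lookup \<alpha> k \<le> Poly_Mapping.lookup \<beta> k"
  have "monomial \<alpha> dvd Poly_Mapping.single \<beta> (Poly_Mapping.lookup p \<beta>)"
    if "\<beta> \<in> Poly_Mapping.keys p" for \<beta>
  proof -
    have "\<beta> = \<alpha> + (\<beta> - \<alpha>)"
      using le that by (intro poly_mapping_eqI) (simp add: lookup_add lookup_minus)
    then have "Poly_Mapping.single \<beta> (Poly_Mapping.lookup p \<beta>) =
        monomial \<alpha> * Poly_Mapping.single (\<beta> - \<alpha>) (Poly_Mapping.lookup p \<beta>)"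
      by (simp add: mult_single)
    then show ?thesis by (rule dvdI)
  qed
  then have "monomial \<alpha> dvd
      (\<Sum>\<beta>\<in>Poly_Mapping.keys p. Poly_Mapping.single \<beta> (Poly_Mapping.lookup p \<beta>))"
    by (rule dvd_sum)
  then show "monomial \<alpha> dvd p"
    by (simp add: sum_single_lookup)
qed

lemma lcm_expo_is_lcm:
  fixes S :: "('n::finite) expo set" and p :: "('n, 'k::comm_ring_1) mpoly"
  assumes "finite S" "S \<noteq> {}"
  shows "\<alpha> \<in> S \<Longrightarrow> (monomial \<alpha> :: ('n, 'k) mpoly) dvd monomial (lcm_expo S)"
    and "(\<And>\<alpha>. \<alpha> \<in> S \<Longrightarrow> monomial \<alpha> dvd p) \<Longrightarrow> monomial (lcm_expo S) dvd p"
  using assms by (auto simp: monomial_dvd_iff lookup_lcm_expo)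


section \<open>Multigraded, uniform rank and squarefree matrices\<close>

text \<open>Rows and columns are numbered from 0, so \<open>[t]\<close> becomes \<open>{..<t}\<close>.\<close>

definition term_mat ::
  "nat \<Rightarrow> nat \<Rightarrow> (nat \<Rightarrow> nat \<Rightarrow> 'k::field_char_0) \<Rightarrow> (nat \<Rightarrow> nat \<Rightarrow> 'n expo) \<Rightarrow>
    ('n, 'k) mpoly mat" where
  "term_mat s l c \<alpha> = mat s l (\<lambda>(i, j). Poly_Mapping.single (\<alpha> i j) (c i j))"

definition minors :: "'a::comm_ring_1 mat \<Rightarrow> 'a set" where
  "minors A = {det (submatrix A I J) | I J.
     I \<subseteq> {..<dim_row A} \<and> J \<subseteq> {..<dim_col A} \<and> card I = card J \<and> I \<noteq> {}}"

definition multigraded :: "('n, 'k::field_char_0) mpoly mat \<Rightarrow> bool" where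
  "multigraded A \<longleftrightarrow> (\<forall>m\<in>minors A. \<exists>c \<alpha>. m = Poly_Mapping.single \<alpha> c)"

definition uniform_rank :: "'a::comm_ring_1 mat \<Rightarrow> bool" where
  "uniform_rank A \<longleftrightarrow> (\<forall>m\<in>minors A. m \<noteq> 0)"

text \<open>The equations of $E_A$ are between vectors of integers.\<close>

definition solves_E ::
  "nat \<Rightarrow> nat \<Rightarrow> (nat \<Rightarrow> nat \<Rightarrow> 'k::field_char_0) \<Rightarrow> (nat \<Rightarrow> nat \<Rightarrow> 'n expo) \<Rightarrow>
    (nat \<Rightarrow> 'n \<Rightarrow> int) \<Rightarrow> (nat \<Rightarrow> 'n \<Rightarrow> int) \<Rightarrow> bool" where
  "solves_E s l c \<alpha> \<gamma> \<beta> \<longleftrightarrow>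
     (\<forall>i<s. \<forall>j<l. c i j \<noteq> 0 \<longrightarrow> (\<forall>k. \<gamma> j k - \<beta> i k = int (Poly_Mapping.lookup (\<alpha> i j) k)))"

definition squarefree_mat ::
  "nat \<Rightarrow> nat \<Rightarrow> (nat \<Rightarrow> nat \<Rightarrow> 'k::field_char_0) \<Rightarrow> (nat \<Rightarrow> nat \<Rightarrow> 'n expo) \<Rightarrow> bool" where
  "squarefree_mat s l c \<alpha> \<longleftrightarrow>
     (\<exists>\<gamma> \<beta>. solves_E s l c \<alpha> \<gamma> \<beta> \<and>
        (\<forall>j<l. \<forall>k. \<gamma> j k \<in> {0, 1}) \<and> (\<forall>i<s. \<forall>k. \<beta> i k \<in> {0, 1}))"


section \<open>Cokernels and annihilators\<close>

abbreviation type_ring :: "'a::comm_ring_1 ring" where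
  "type_ring \<equiv> ring_of_type_algebra"

definition quot_module :: "('a, 'b, 'm) module_scheme \<Rightarrow> 'b set \<Rightarrow> ('a, 'b set) module" where
  "quot_module M N = \<lparr>
     carrier = a_rcosets\<^bsub>M\<^esub> N,
     monoid.mult = undefined,
     one = undefined,
     zero = N,
     add = set_add M,
     module.smult = (\<lambda>r C. \<Union>x\<in>C. N +>\<^bsub>M\<^esub> (r \<odot>\<^bsub>M\<^esub> x))\<rparr>"

lemma module_quot_module:
  assumes "module R M" and "submodule N R M"
  shows "module R (quot_module M N)"
proof -
  interpret module R M by fact
  interpret N: submodule N R M by fact
  have N: "N \<subseteq> carrier M" using N.subset by simp
  have ab: "abelian_subgroup N M"
    by (rule abelian_subgroupI3)
      (auto intro!: additive_subgroup.intro M.abelian_group_axioms N.subgroup_axioms)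
  interpret N: abelian_subgroup N M by (rule ab)
  have add: "N +>\<^bsub>M\<^esub> x <+>\<^bsub>M\<^esub> (N +>\<^bsub>M\<^esub> y) = N +>\<^bsub>M\<^esub> (x \<oplus>\<^bsub>M\<^esub> y)"
    if "x \<in> carrier M" "y \<in> carrier M" for x y
    using that by (rule N.a_rcos_sum)
  have smult: "(\<Union>y\<in>N +>\<^bsub>M\<^esub> x. N +>\<^bsub>M\<^esub> (r \<odot>\<^bsub>M\<^esub> y)) = N +>\<^bsub>M\<^esub> (r \<odot>\<^bsub>M\<^esub> x)"
    if r: "r \<in> carrier R" and x: "x \<in> carrier M" for r x
  proof -
    have "N +>\<^bsub>M\<^esub> (r \<odot>\<^bsub>M\<^esub> y) = N +>\<^bsub>M\<^esub> (r \<odot>\<^bsub>M\<^esub> x)" if y: "y \<in> N +>\<^bsub>M\<^esub> x" for y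
    proof -
      obtain h where h: "h \<in> N" "y = h \<oplus>\<^bsub>M\<^esub> x"
        using y unfolding AbelCoset.a_r_coset_def' UN_iff singleton_iff by (elim bexE)
      then have "r \<odot>\<^bsub>M\<^esub> y = r \<odot>\<^bsub>M\<^esub> h \<oplus>\<^bsub>M\<^esub> r \<odot>\<^bsub>M\<^esub> x" and "r \<odot>\<^bsub>M\<^esub> h \<in> N"
        using N r x by (simp_all add: smult_r_distr subsetD)
      then have "r \<odot>\<^bsub>M\<^esub> y \<in> N +>\<^bsub>M\<^esub> (r \<odot>\<^bsub>M\<^esub> x)"
        unfolding AbelCoset.a_r_coset_def' UN_iff by (metis singletonI)
      then show ?thesis
        using r x by (intro N.a_repr_independence'[symmetric]) simp_all
    qed
    moreover have "x \<in> N +>\<^bsub>M\<^esub> x"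
      using x by (rule N.a_rcos_self)
    ultimately show ?thesis by blast
  qed
  have carr: "carrier (quot_module M N) = (\<lambda>x. N +>\<^bsub>M\<^esub> x) ` carrier M"
    and plus: "(N +>\<^bsub>M\<^esub> x) \<oplus>\<^bsub>quot_module M N\<^esub> (N +>\<^bsub>M\<^esub> y) = N +>\<^bsub>M\<^esub> (x \<oplus>\<^bsub>M\<^esub> y)"
    and zero: "\<zero>\<^bsub>quot_module M N\<^esub> = N +>\<^bsub>M\<^esub> \<zero>\<^bsub>M\<^esub>"
    and times: "r \<odot>\<^bsub>quot_module M N\<^esub> (N +>\<^bsub>M\<^esub> x) = N +>\<^bsub>M\<^esub> (r \<odot>\<^bsub>M\<^esub> x)"
    if "x \<in> carrier M" "y \<in> carrier M" "r \<in> carrier R" for x y r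
    using that N add[of x y] smult[of r x] M.a_coset_add_zero[of N]
    by (auto simp: quot_module_def AbelCoset.A_RCOSETS_def')
  note zero' = zero[OF M.zero_closed M.zero_closed R.zero_closed]
  note carr' = carr[OF M.zero_closed M.zero_closed R.zero_closed]
  have grp: "abelian_group (quot_module M N)"
  proof (rule abelian_groupI; unfold carr' zero')
    fix C assume "C \<in> (\<lambda>x. N +>\<^bsub>M\<^esub> x) ` carrier M"
    then obtain x where x: "x \<in> carrier M" "C = N +>\<^bsub>M\<^esub> x" by blast
    then have "(N +>\<^bsub>M\<^esub> (\<ominus>\<^bsub>M\<^esub> x)) \<oplus>\<^bsub>quot_module M N\<^esub> C = N +>\<^bsub>M\<^esub> \<zero>\<^bsub>M\<^esub>"
      by (simp add: plus[OF _ _ R.zero_closed] M.l_neg)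
    then show "\<exists>D\<in>(\<lambda>x. N +>\<^bsub>M\<^esub> x) ` carrier M. D \<oplus>\<^bsub>quot_module M N\<^esub> C = N +>\<^bsub>M\<^esub> \<zero>\<^bsub>M\<^esub>"
      using x by blast
  qed (auto simp: plus[OF _ _ R.zero_closed] M.a_ac)
  show ?thesis
    by (rule moduleI; (unfold carr')?)
      (auto simp: plus[OF _ _ R.zero_closed] times[OF _ M.zero_closed] smult_l_distr
        smult_r_distr smult_assoc1 intro: R.is_cring grp)
qed

definition annihilator ::
  "('a, 'r) ring_scheme \<Rightarrow> ('a, 'b, 'm) module_scheme \<Rightarrow> 'a set" where
  "annihilator R M = {r \<in> carrier R. \<forall>x\<in>carrier M. r \<odot>\<^bsub>M\<^esub> x = \<zero>\<^bsub>M\<^esub>}"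

text \<open>
  The map $\phi$ sends the basis vector $w_j$ to the \<open>j\<close>-th column of \<open>A\<close>, that is, it is
  multiplication by \<open>A\<close> from the left.  The grading of $M_A$ does not affect its annihilator
  and is left out.
\<close>

definition mat_image :: "'a::comm_ring_1 mat \<Rightarrow> 'a vec set" where
  "mat_image A = (\<lambda>w. A *\<^sub>v w) ` carrier_vec (dim_col A)"

definition coker :: "'a::comm_ring_1 mat \<Rightarrow> ('a, 'a vec set) module" where
  "coker A = quot_module (module_vec TYPE('a) (dim_row A)) (mat_image A)"

lemma module_coker: "module type_ring (coker (A :: 'a::comm_ring_1 mat))"
proof -
  let ?V = "module_vec TYPE('a) (dim_row A)"
  have grp: "abelian_group ?V"
  proof (rule abelian_groupI)
    fix x assume "x \<in> carrier ?V"
    then show "\<exists>y\<in>carrier ?V. y \<oplus>\<^bsub>?V\<^esub> x = \<zero>\<^bsub>?V\<^esub>"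
      by (intro bexI[of _ "- x"]) (auto simp: module_vec_simps)
  qed (auto simp: module_vec_simps)
  have V: "module type_ring ?V"
  proof (rule moduleI)
    show "cring (type_ring :: 'a ring)"
      by (rule cring_from_type_algebra)
    show "abelian_group ?V" by (rule grp)
  qed (auto simp: module_vec_simps ring_of_type_algebra_def
      add_smult_distrib_vec smult_add_distrib_vec smult_smult_assoc)
  have A: "A \<in> carrier_mat (dim_row A) (dim_col A)" by simp
  have "submodule (mat_image A) type_ring ?V"
  proof (rule module.submoduleI[OF V])
    show sub: "mat_image A \<subseteq> carrier ?V"
      using A by (auto simp: mat_image_def module_vec_simps intro: mult_mat_vec_carrier)
    show "\<zero>\<^bsub>?V\<^esub> \<in> mat_image A"
      unfolding mat_image_def
      by (rule image_eqI[of _ _ "0\<^sub>v (dim_col A)"]) (auto simp: module_vec_simps)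
    show smult: "r \<odot>\<^bsub>?V\<^esub> x \<in> mat_image A" if x: "x \<in> mat_image A" for r x
    proof -
      obtain w where w: "w \<in> carrier_vec (dim_col A)" "x = A *\<^sub>v w"
        using x unfolding mat_image_def by (elim imageE)
      then have "r \<odot>\<^bsub>?V\<^esub> x = A *\<^sub>v (r \<cdot>\<^sub>v w)"
        by (auto simp: module_vec_simps mult_mat_vec)
      then show ?thesis using w by (auto simp: mat_image_def)
    qed
    show "x \<oplus>\<^bsub>?V\<^esub> y \<in> mat_image A" if xy: "x \<in> mat_image A" "y \<in> mat_image A" for x y
    proof -
      obtain v w where w: "v \<in> carrier_vec (dim_col A)" "x = A *\<^sub>v v"
        "w \<in> carrier_vec (dim_col A)" "y = A *\<^sub>v w"
        using xy unfolding mat_image_def by (elim imageE)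
      then have "x \<oplus>\<^bsub>?V\<^esub> y = A *\<^sub>v (v + w)"
        by (simp add: module_vec_simps mult_add_distrib_mat_vec[OF A])
      then show ?thesis using w by (auto simp: mat_image_def)
    qed
    show "\<ominus>\<^bsub>?V\<^esub> x \<in> mat_image A" if "x \<in> mat_image A" for x
    proof -
      have x: "x \<in> carrier_vec (dim_row A)"
        using that sub by (simp only: module_vec_simps subsetD)
      have "(- 1) \<cdot>\<^sub>v x + x = 0\<^sub>v (dim_row A)"
        using x by (intro eq_vecI) auto
      then have "\<ominus>\<^bsub>?V\<^esub> x = (- 1) \<cdot>\<^sub>v x"
        using x by (intro abelian_group.minus_equality[OF grp]) (simp_all only: module_vec_simps smult_carrier_vec)
      then show ?thesis
        using smult[OF that, of "- 1"] by (simp add: module_vec_simps)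
    qed
  qed
  with V show ?thesis
    unfolding coker_def by (rule module_quot_module)
qed


section \<open>The ideals \<open>I\<^sub>i\<close>\<close>

text \<open>
  With rows numbered from 0, row \<open>i\<close> here is row $i+1$ in the usual numbering, so the sets
  of columns of size $s-(i+1)+1$ become sets of size \<open>s - i\<close>.
\<close>

definition row_ideal ::
  "nat \<Rightarrow> nat \<Rightarrow> (nat \<Rightarrow> nat \<Rightarrow> ('n::finite) expo) \<Rightarrow> nat \<Rightarrow> ('n, 'k::field_char_0) mpoly set" where
  "row_ideal s l \<alpha> i =
     Idl\<^bsub>type_ring\<^esub> {monomial (lcm_expo (\<alpha> i ` J)) | J. J \<subseteq> {..<l} \<and> card J = s - i}"

end

theory Submission
  imports Defs
begin

text \<open>
  Squarefreeness forces every variable to occur in the entries either through the row degrees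
  only or through the column degrees only, so that $x^{\alpha_{ij}} = x^{r_i} x^{m_j}$ with
  \<open>r\<^sub>i\<close> and \<open>m\<^sub>j\<close> of disjoint support, and \<open>A\<close> is a matrix of scalars multiplied by
  diagonal matrices of monomials from both sides.  A monomial lies in both ideals if and only
  if it is divisible by all entries of some \<open>s\<close> columns.  Such a monomial annihilates $M_A$
  because the scalar maximal minor on these columns is invertible.  Conversely, if \<open>f\<close>
  annihilates $M_A$, comparing coefficients at a monomial of \<open>f\<close> factors a nonzero multiple of
  the identity of size \<open>s\<close> through the scalar columns whose entries divide that monomial, so
  there are at least \<open>s\<close> of them.
\<close>


section \<open>Monomial ideals\<close>

lemma type_ring_simps:
  "carrier type_ring = UNIV"
  "x \<otimes>\<^bsub>type_ring\<^esub> y = x * y"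
  "x \<oplus>\<^bsub>type_ring\<^esub> y = x + y"
  "\<zero>\<^bsub>type_ring\<^esub> = 0"
  by (simp_all add: ring_of_type_algebra_def)

lemma ideal_type_ringI:
  fixes I :: "'a::comm_ring_1 set"
  assumes zero_mem: "0 \<in> I"
    and add_mem: "\<And>x y. x \<in> I \<Longrightarrow> y \<in> I \<Longrightarrow> x + y \<in> I"
    and mult_mem: "\<And>r x. x \<in> I \<Longrightarrow> r * x \<in> I"
  shows "ideal I type_ring"
proof -
  interpret cring "type_ring :: 'a ring"
    by (rule cring_from_type_algebra)
  show ?thesis
  proof (rule idealI[OF ring_axioms])
    show "subgroup I (add_monoid type_ring)"
    proof (rule add.subgroupI)
      show "\<ominus>\<^bsub>type_ring\<^esub> x \<in> I" if "x \<in> I" for x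
      proof -
        have "\<ominus>\<^bsub>type_ring\<^esub> x = - 1 * x"
          by (rule minus_equality) (simp_all add: type_ring_simps)
        then show ?thesis
          using mult_mem[OF that, of "- 1"] by simp
      qed
      show "I \<noteq> {}"
        using zero_mem by blast
    qed (use add_mem in \<open>simp_all add: type_ring_simps\<close>)
  qed (use mult_mem in \<open>auto simp: type_ring_simps mult.commute\<close>)
qed

lemma ideal_type_ring_closed:
  fixes I :: "'a::comm_ring_1 set"
  assumes "ideal I type_ring"
  shows "0 \<in> I" and "x \<in> I \<Longrightarrow> y \<in> I \<Longrightarrow> x + y \<in> I" and "x \<in> I \<Longrightarrow> r * x \<in> I"
proof -
  interpret ideal I type_ring by fact
  show "0 \<in> I"
    using additive_subgroup.zero_closed[OF additive_subgroup_axioms] by (simp add: type_ring_simps)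
  show "x \<in> I \<Longrightarrow> y \<in> I \<Longrightarrow> x + y \<in> I"
    using additive_subgroup.a_closed[OF additive_subgroup_axioms, of x y] by (simp add: type_ring_simps)
  show "x \<in> I \<Longrightarrow> r * x \<in> I"
    using I_l_closed[of x r] by (simp add: type_ring_simps)
qed

lemma ideal_type_ring_sum:
  fixes I :: "'a::comm_ring_1 set"
  assumes "ideal I type_ring" and "\<And>x. x \<in> S \<Longrightarrow> f x \<in> I"
  shows "sum f S \<in> I"
  using assms(2)
  by (induction S rule: infinite_finite_induct) (auto intro: ideal_type_ring_closed[OF assms(1)])

text \<open>Membership is decided term by term: the polynomials whose exponents all lie above some
  generator are closed under sums and multiples, and each term of such a polynomial is a multiple of
  a generator.\<close>

lemma mem_monomial_ideal_iff:
  fixes f :: "('n, 'k::comm_ring_1) mpoly"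
  shows "f \<in> Idl\<^bsub>type_ring\<^esub> (monomial ` S) \<longleftrightarrow>
    (\<forall>\<beta>\<in>Poly_Mapping.keys f. \<exists>\<alpha>\<in>S. \<exists>\<delta>. \<beta> = \<alpha> + \<delta>)"
proof -
  interpret cring "type_ring :: ('n, 'k) mpoly ring"
    by (rule cring_from_type_algebra)
  let ?I = "{f :: ('n, 'k) mpoly. \<forall>\<beta>\<in>Poly_Mapping.keys f. \<exists>\<alpha>\<in>S. \<exists>\<delta>. \<beta> = \<alpha> + \<delta>}"
  let ?J = "Idl\<^bsub>type_ring\<^esub> (monomial ` S) :: ('n, 'k) mpoly set"
  have J: "ideal ?J type_ring"
    by (rule genideal_ideal) (simp add: type_ring_simps)
  have "?J \<subseteq> ?I"
  proof (rule genideal_minimal)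
    show "ideal ?I type_ring"
    proof (rule ideal_type_ringI)
      fix x y assume "x \<in> ?I" "y \<in> ?I"
      then show "x + y \<in> ?I"
        using Poly_Mapping.keys_add[of x y] by blast
    next
      fix r x assume x: "x \<in> ?I"
      have "\<exists>\<alpha>\<in>S. \<exists>\<delta>. \<beta> = \<alpha> + \<delta>" if \<beta>_mem: "\<beta> \<in> Poly_Mapping.keys (r * x)" for \<beta>
      proof -
        obtain \<mu> \<nu> where "\<nu> \<in> Poly_Mapping.keys x" and \<beta>: "\<beta> = \<mu> + \<nu>"
          using \<beta>_mem keys_mult[of r x] by blast
        then obtain \<alpha> \<delta> where "\<alpha> \<in> S" "\<nu> = \<alpha> + \<delta>"
          using x by blast
        with \<beta> have "\<beta> = \<alpha> + (\<mu> + \<delta>)"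
          by (simp add: add.left_commute)
        with \<open>\<alpha> \<in> S\<close> show ?thesis by blast
      qed
      then show "r * x \<in> ?I" by blast
    qed simp
  qed (auto, metis add.right_neutral)
  moreover have "f \<in> ?J" if f: "f \<in> ?I" for f
  proof -
    have "Poly_Mapping.single \<beta> (Poly_Mapping.lookup f \<beta>) \<in> ?J"
      if \<beta>_mem: "\<beta> \<in> Poly_Mapping.keys f" for \<beta>
    proof -
      obtain \<alpha> \<delta> where "\<alpha> \<in> S" and \<beta>: "\<beta> = \<alpha> + \<delta>"
        using f \<beta>_mem by blast
      then have "monomial \<alpha> \<in> ?J"
        using genideal_self[of "monomial ` S"] by (auto simp: type_ring_simps)
      then have "Poly_Mapping.single \<delta> (Poly_Mapping.lookup f \<beta>) * monomial \<alpha> \<in> ?J"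
        by (rule ideal_type_ring_closed[OF J])
      then show ?thesis
        by (simp add: mult_single \<beta> add.commute)
    qed
    then have "(\<Sum>\<beta>\<in>Poly_Mapping.keys f. Poly_Mapping.single \<beta> (Poly_Mapping.lookup f \<beta>)) \<in> ?J"
      by (rule ideal_type_ring_sum[OF J])
    then show ?thesis
      by (simp add: sum_single_lookup)
  qed
  ultimately show ?thesis by blast
qed

lemma expo_add_iff:
  fixes \<alpha> \<beta> :: "'n expo"
  shows "(\<exists>\<delta>. \<beta> = \<alpha> + \<delta>) \<longleftrightarrow> (\<forall>k. Poly_Mapping.lookup \<alpha> k \<le> Poly_Mapping.lookup \<beta> k)"
proof
  assume "\<forall>k. Poly_Mapping.lookup \<alpha> k \<le> Poly_Mapping.lookup \<beta> k"
  then have "\<beta> = \<alpha> + (\<beta> - \<alpha>)"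
    by (intro poly_mapping_eqI) (simp add: lookup_add lookup_minus)
  then show "\<exists>\<delta>. \<beta> = \<alpha> + \<delta>" by blast
qed (auto simp: lookup_add)

text \<open>An lcm divides a monomial iff all of its arguments do. The hypothesis
  \<open>i < s\<close> keeps the column sets nonempty, so that the maximum inside
  \<open>lcm_expo\<close> is meaningful.\<close>

lemma mem_row_ideal_iff:
  fixes f :: "('n::finite, 'k::field_char_0) mpoly"
  assumes "i < s"
  shows "f \<in> row_ideal s l \<alpha> i \<longleftrightarrow>
    (\<forall>\<beta>\<in>Poly_Mapping.keys f. \<exists>J\<subseteq>{..<l}. card J = s - i \<and>
      (\<forall>j\<in>J. \<forall>k. Poly_Mapping.lookup (\<alpha> i j) k \<le> Poly_Mapping.lookup \<beta> k))"
proof -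
  have lcm_le: "(\<forall>k. Poly_Mapping.lookup (lcm_expo (\<alpha> i ` J)) k \<le> Poly_Mapping.lookup \<beta> k) \<longleftrightarrow>
      (\<forall>j\<in>J. \<forall>k. Poly_Mapping.lookup (\<alpha> i j) k \<le> Poly_Mapping.lookup \<beta> k)"
    if J: "J \<subseteq> {..<l}" "card J = s - i" for J and \<beta> :: "'n expo"
  proof -
    have "finite J" "J \<noteq> {}"
      using J assms by (auto intro: finite_subset)
    then show ?thesis
      by (auto simp: lookup_lcm_expo)
  qed
  have "{monomial (lcm_expo (\<alpha> i ` J)) | J. J \<subseteq> {..<l} \<and> card J = s - i} =
      (monomial ` {lcm_expo (\<alpha> i ` J) | J. J \<subseteq> {..<l} \<and> card J = s - i} :: ('n, 'k) mpoly set)"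
    by auto
  then have "f \<in> row_ideal s l \<alpha> i \<longleftrightarrow> (\<forall>\<beta>\<in>Poly_Mapping.keys f.
      \<exists>\<mu>\<in>{lcm_expo (\<alpha> i ` J) | J. J \<subseteq> {..<l} \<and> card J = s - i}. \<exists>\<delta>. \<beta> = \<mu> + \<delta>)"
    by (simp only: row_ideal_def mem_monomial_ideal_iff)
  also have "\<dots> \<longleftrightarrow> (\<forall>\<beta>\<in>Poly_Mapping.keys f. \<exists>J. J \<subseteq> {..<l} \<and> card J = s - i \<and>
      (\<forall>k. Poly_Mapping.lookup (lcm_expo (\<alpha> i ` J)) k \<le> Poly_Mapping.lookup \<beta> k))"
    unfolding expo_add_iff by (rule ball_cong[OF refl]) blast
  also have "\<dots> \<longleftrightarrow> (\<forall>\<beta>\<in>Poly_Mapping.keys f. \<exists>J\<subseteq>{..<l}. card J = s - i \<and>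
      (\<forall>j\<in>J. \<forall>k. Poly_Mapping.lookup (\<alpha> i j) k \<le> Poly_Mapping.lookup \<beta> k))"
    by (intro ball_cong refl arg_cong[where f = Ex] ext conj_cong lcm_le)
  finally show ?thesis .
qed


section \<open>The annihilator of a cokernel\<close>

text \<open>A polynomial kills the cokernel iff it sends every basis vector into the image of
  \<open>A\<close>; preimages of these multiples are the columns of \<open>W\<close>.\<close>

lemma mem_annihilator_coker_iff:
  fixes A :: "'a::comm_ring_1 mat"
  assumes A: "A \<in> carrier_mat s l"
  shows "f \<in> annihilator type_ring (coker A) \<longleftrightarrow>
    (\<exists>W\<in>carrier_mat l s. A * W = f \<cdot>\<^sub>m 1\<^sub>m s)"
proof -
  let ?N = "mat_image A"
  let ?V = "module_vec TYPE('a) s"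
  have N: "x \<in> ?N \<longleftrightarrow> (\<exists>w\<in>carrier_vec l. x = A *\<^sub>v w)" for x
    using A by (auto simp: mat_image_def)
  have N_carrier: "x \<in> carrier_vec s" if "x \<in> ?N" for x
    using that A by (auto simp: N)
  have N_add: "x + y \<in> ?N" if xy: "x \<in> ?N" "y \<in> ?N" for x y
  proof -
    obtain v w where "v \<in> carrier_vec l" "w \<in> carrier_vec l" "x = A *\<^sub>v v" "y = A *\<^sub>v w"
      using xy unfolding N by blast
    then show ?thesis
      unfolding N using mult_add_distrib_mat_vec[OF A, of v w] by (intro bexI[of _ "v + w"]) auto
  qed
  have N_smult: "r \<cdot>\<^sub>v x \<in> ?N" if x: "x \<in> ?N" for r x
  proof -
    obtain w where w: "w \<in> carrier_vec l" "x = A *\<^sub>v w"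
      using x unfolding N by blast
    have "A *\<^sub>v (r \<cdot>\<^sub>v w) = r \<cdot>\<^sub>v (A *\<^sub>v w)"
      using A w(1) by (intro eq_vecI) (auto simp: scalar_prod_smult_distrib[of _ l])
    then show ?thesis
      unfolding N using w by (intro bexI[of _ "r \<cdot>\<^sub>v w"]) simp_all
  qed
  have N_zero: "0\<^sub>v s \<in> ?N"
    unfolding N using A by (intro bexI[of _ "0\<^sub>v l"]) auto
  have coset: "?N +>\<^bsub>?V\<^esub> x = {n + x | n. n \<in> ?N}" for x
    by (auto simp: AbelCoset.a_r_coset_def' module_vec_simps)
  have coset_self: "x \<in> ?N +>\<^bsub>?V\<^esub> x" if "x \<in> carrier_vec s" for x
    unfolding coset using N_zero that by force
  have coset_mem: "?N +>\<^bsub>?V\<^esub> x = ?N" if x: "x \<in> ?N" for x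
  proof
    show "?N +>\<^bsub>?V\<^esub> x \<subseteq> ?N"
      using x N_add by (auto simp: coset)
    show "?N \<subseteq> ?N +>\<^bsub>?V\<^esub> x"
    proof
      fix y assume y: "y \<in> ?N"
      have "y = (y + (- 1) \<cdot>\<^sub>v x) + x"
        using N_carrier[OF x] N_carrier[OF y] by (intro eq_vecI) auto
      then show "y \<in> ?N +>\<^bsub>?V\<^esub> x"
        unfolding coset using N_add[OF y N_smult[OF x]] by blast
    qed
  qed
  have "f \<in> annihilator type_ring (coker A) \<longleftrightarrow>
      (\<forall>v\<in>carrier_vec s. (\<Union>x\<in>?N +>\<^bsub>?V\<^esub> v. ?N +>\<^bsub>?V\<^esub> (f \<cdot>\<^sub>v x)) = ?N)"
    using A by (auto simp: annihilator_def coker_def quot_module_def type_ring_simps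
        AbelCoset.A_RCOSETS_def' module_vec_simps)
  also have "\<dots> \<longleftrightarrow> (\<forall>v\<in>carrier_vec s. f \<cdot>\<^sub>v v \<in> ?N)"
  proof (intro ball_cong refl iffI)
    fix v :: "'a vec" assume v: "v \<in> carrier_vec s"
    assume eq: "(\<Union>x\<in>?N +>\<^bsub>?V\<^esub> v. ?N +>\<^bsub>?V\<^esub> (f \<cdot>\<^sub>v x)) = ?N"
    have "f \<cdot>\<^sub>v v \<in> (\<Union>x\<in>?N +>\<^bsub>?V\<^esub> v. ?N +>\<^bsub>?V\<^esub> (f \<cdot>\<^sub>v x))"
      using v by (intro UN_I[of v] coset_self) simp_all
    then show "f \<cdot>\<^sub>v v \<in> ?N"
      unfolding eq .
  next
    fix v :: "'a vec" assume v: "v \<in> carrier_vec s" and fv: "f \<cdot>\<^sub>v v \<in> ?N"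
    \<comment> \<open>Scalar multiplication on the quotient is a union over all representatives, so
      every one of them has to be sent into \<open>?N\<close>.\<close>
    have "?N +>\<^bsub>?V\<^esub> (f \<cdot>\<^sub>v x) = ?N" if x: "x \<in> ?N +>\<^bsub>?V\<^esub> v" for x
    proof -
      obtain n where n: "n \<in> ?N" "x = n + v"
        using x by (auto simp: coset)
      then have "f \<cdot>\<^sub>v x = f \<cdot>\<^sub>v n + f \<cdot>\<^sub>v v"
        using smult_add_distrib_vec[OF N_carrier[OF n(1)] v] by simp
      then show ?thesis
        using N_add[OF N_smult[OF n(1)] fv] by (simp add: coset_mem)
    qed
    then have "(\<Union>x\<in>?N +>\<^bsub>?V\<^esub> v. ?N +>\<^bsub>?V\<^esub> (f \<cdot>\<^sub>v x)) = (\<Union>x\<in>?N +>\<^bsub>?V\<^esub> v. ?N)"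
      by (rule SUP_cong[OF refl])
    then show "(\<Union>x\<in>?N +>\<^bsub>?V\<^esub> v. ?N +>\<^bsub>?V\<^esub> (f \<cdot>\<^sub>v x)) = ?N"
      using coset_self[OF v] by (metis UN_constant empty_iff)
  qed
  also have "\<dots> \<longleftrightarrow> (\<exists>W\<in>carrier_mat l s. A * W = f \<cdot>\<^sub>m 1\<^sub>m s)"
  proof
    assume "\<forall>v\<in>carrier_vec s. f \<cdot>\<^sub>v v \<in> ?N"
    \<comment> \<open>For \<open>i\<close> at least \<open>s\<close> the vector
      \<open>unit_vec s i\<close> is zero but still has dimension \<open>s\<close>, so the choice of
      \<open>w\<close> can be made for all \<open>i\<close> at once.\<close>
    then have "\<forall>i. \<exists>w\<in>carrier_vec l. f \<cdot>\<^sub>v unit_vec s i = A *\<^sub>v w"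
      by (auto simp: N)
    then obtain w where w: "\<And>i. w i \<in> carrier_vec l" "\<And>i. f \<cdot>\<^sub>v unit_vec s i = A *\<^sub>v w i"
      by metis
    let ?W = "mat l s (\<lambda>(j, i). w i $ j)"
    have "A * ?W = f \<cdot>\<^sub>m 1\<^sub>m s"
    proof (rule eq_matI)
      fix i' i assume "i' < dim_row (f \<cdot>\<^sub>m 1\<^sub>m s)" "i < dim_col (f \<cdot>\<^sub>m 1\<^sub>m s)"
      then have i: "i' < s" "i < s" by auto
      have col: "col ?W i = w i"
        using i w(1)[of i] by (intro eq_vecI) auto
      have "(A * ?W) $$ (i', i) = row A i' \<bullet> col ?W i"
        using A i by (intro index_mult_mat(1)) auto
      also have "\<dots> = (A *\<^sub>v w i) $ i'"
        unfolding col using A i by simp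
      also have "\<dots> = (f \<cdot>\<^sub>m 1\<^sub>m s) $$ (i', i)"
        using i by (simp flip: w(2))
      finally show "(A * ?W) $$ (i', i) = (f \<cdot>\<^sub>m 1\<^sub>m s) $$ (i', i)" .
    qed (use A in auto)
    then show "\<exists>W\<in>carrier_mat l s. A * W = f \<cdot>\<^sub>m 1\<^sub>m s"
      by (intro bexI[of _ ?W]) auto
  next
    assume "\<exists>W\<in>carrier_mat l s. A * W = f \<cdot>\<^sub>m 1\<^sub>m s"
    then obtain W where W: "W \<in> carrier_mat l s" "A * W = f \<cdot>\<^sub>m 1\<^sub>m s" by blast
    show "\<forall>v\<in>carrier_vec s. f \<cdot>\<^sub>v v \<in> ?N"
    proof
      fix v :: "'a vec" assume v: "v \<in> carrier_vec s"
      have "A *\<^sub>v (W *\<^sub>v v) = (f \<cdot>\<^sub>m 1\<^sub>m s) *\<^sub>v v"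
        using A W v by (simp flip: assoc_mult_mat_vec)
      also have "\<dots> = f \<cdot>\<^sub>v v"
        using v by (intro eq_vecI) auto
      finally show "f \<cdot>\<^sub>v v \<in> ?N"
        unfolding N using W v by (metis mult_mat_vec_carrier)
    qed
  qed
  finally show ?thesis .
qed

text \<open>This allows annihilation of a polynomial to be deduced from annihilation by its single
  terms.\<close>

lemma ideal_annihilator_coker:
  fixes A :: "'a::comm_ring_1 mat"
  shows "ideal (annihilator type_ring (coker A)) type_ring"
proof -
  define s l where "s = dim_row A" and "l = dim_col A"
  have A: "A \<in> carrier_mat s l"
    by (simp add: s_def l_def)
  note iff = mem_annihilator_coker_iff[OF A]
  show ?thesis
  proof (rule ideal_type_ringI)
    have "A * 0\<^sub>m l s = 0 \<cdot>\<^sub>m 1\<^sub>m s"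
      using A by (intro eq_matI) (auto simp: scalar_prod_def)
    then show "0 \<in> annihilator type_ring (coker A)"
      unfolding iff by (metis zero_carrier_mat)
  next
    fix x y assume "x \<in> annihilator type_ring (coker A)" "y \<in> annihilator type_ring (coker A)"
    then obtain V W where VW: "V \<in> carrier_mat l s" "A * V = x \<cdot>\<^sub>m 1\<^sub>m s"
      "W \<in> carrier_mat l s" "A * W = y \<cdot>\<^sub>m 1\<^sub>m s"
      unfolding iff by blast
    then have "A * (V + W) = x \<cdot>\<^sub>m 1\<^sub>m s + y \<cdot>\<^sub>m 1\<^sub>m s"
      using A by (simp add: mult_add_distrib_mat)
    then have "A * (V + W) = (x + y) \<cdot>\<^sub>m 1\<^sub>m s"
      by (simp add: add_smult_distrib_right_mat[of _ s s])
    then show "x + y \<in> annihilator type_ring (coker A)"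
      unfolding iff using VW by (metis add_carrier_mat)
  next
    fix r x assume "x \<in> annihilator type_ring (coker A)"
    then obtain W where W: "W \<in> carrier_mat l s" "A * W = x \<cdot>\<^sub>m 1\<^sub>m s"
      unfolding iff by blast
    then have "A * (r \<cdot>\<^sub>m W) = (r * x) \<cdot>\<^sub>m 1\<^sub>m s"
      using A by (subst mult_smult_distrib) (auto intro!: eq_matI)
    then show "r * x \<in> annihilator type_ring (coker A)"
      unfolding iff using W by (metis smult_carrier_mat)
  qed
qed


section \<open>Squarefree matrices of uniform rank\<close>

lemma single_sum:
  "Poly_Mapping.single \<mu> (sum g S) = (\<Sum>x\<in>S. Poly_Mapping.single \<mu> (g x))"
  by (induction S rule: infinite_finite_induct) (simp_all add: single_add)

lemma prod_single:
  fixes g :: "_ \<Rightarrow> 'k::comm_ring_1"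
  shows "(\<Prod>x\<in>S. Poly_Mapping.single (\<mu> x) (g x)) = Poly_Mapping.single (sum \<mu> S) (prod g S)"
  by (induction S rule: infinite_finite_induct) (simp_all add: mult_single)

text \<open>Each product in the Leibniz expansion meets every row and every column once, so all of
  them carry the same monomial, and only the scalar determinant remains as coefficient.\<close>

lemma det_single_add:
  fixes c :: "nat \<Rightarrow> nat \<Rightarrow> 'k::comm_ring_1" and r m :: "nat \<Rightarrow> 'n expo"
  shows "det (mat t t (\<lambda>(p, q). Poly_Mapping.single (r p + m q) (c p q))) =
    Poly_Mapping.single (sum r {0..<t} + sum m {0..<t}) (det (mat t t (\<lambda>(p, q). c p q)))"
proof -
  have "signof \<pi> * (\<Prod>p = 0..<t. mat t t (\<lambda>(p, q). Poly_Mapping.single (r p + m q) (c p q)) $$ (p, \<pi> p)) =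
      Poly_Mapping.single (sum r {0..<t} + sum m {0..<t})
        (signof \<pi> * (\<Prod>p = 0..<t. mat t t (\<lambda>(p, q). c p q) $$ (p, \<pi> p)))"
    if \<pi>: "\<pi> permutes {0..<t}" for \<pi>
  proof -
    have lt: "\<pi> p < t" if "p < t" for p
      using permutes_in_image[OF \<pi>, of p] that by simp
    have "(\<Sum>p = 0..<t. r p + m (\<pi> p)) = sum r {0..<t} + sum m {0..<t}"
      using sum.permute[OF \<pi>, of m] by (simp add: sum.distrib comp_def)
    then have "(\<Prod>p = 0..<t. mat t t (\<lambda>(p, q). Poly_Mapping.single (r p + m q) (c p q)) $$ (p, \<pi> p)) =
        Poly_Mapping.single (sum r {0..<t} + sum m {0..<t})
          (\<Prod>p = 0..<t. mat t t (\<lambda>(p, q). c p q) $$ (p, \<pi> p))"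
      using lt by (simp add: prod_single)
    then show ?thesis
      by (simp add: sign_def single_uminus)
  qed
  then show ?thesis
    by (simp add: det_def'[of _ t] single_sum)
qed

lemma pick_lessThan: "i < n \<Longrightarrow> pick {..<n} i = i"
proof -
  assume "i < n"
  then have "{a \<in> {..<n}. a < i} = {..<i}" by auto
  then show ?thesis
    using pick_card_in_set[of i "{..<n}"] \<open>i < n\<close> by simp
qed

text \<open>This translates sums over a set of columns into sums over the indices of a square
  matrix.\<close>

lemma bij_betw_pick:
  assumes "finite J"
  shows "bij_betw (pick J) {0..<card J} J"
proof -
  have inj: "inj_on (pick J) {0..<card J}"
    using pick_mono_le[of _ J] by (intro linorder_inj_onI) force+
  moreover have "pick J ` {0..<card J} \<subseteq> J"
    using pick_in_set_le[of _ J] by auto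
  ultimately have "pick J ` {0..<card J} = J"
    by (intro card_subset_eq) (simp_all add: assms card_image)
  with inj show ?thesis
    by (simp add: bij_betw_def)
qed

lemma submatrix_in_minors:
  assumes "A \<in> carrier_mat s l" "I \<subseteq> {..<s}" "J \<subseteq> {..<l}" "card I = card J" "I \<noteq> {}"
  shows "det (submatrix A I J) \<in> minors A"
  using assms unfolding minors_def by auto

lemma submatrix_eq_mat:
  assumes "A \<in> carrier_mat s l" "I \<subseteq> {..<s}" "J \<subseteq> {..<l}"
  shows "submatrix A I J = mat (card I) (card J) (\<lambda>(p, q). A $$ (pick I p, pick J q))"
proof -
  have "{i. i < s \<and> i \<in> I} = I" "{j. j < l \<and> j \<in> J} = J"
    using assms by auto
  then show ?thesis
    using assms by (simp add: submatrix_def)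
qed

text \<open>The entries are the minors of size 1. Hence $E_A$ has an equation for every position of
  the matrix.\<close>

lemma uniform_rank_coeff_nonzero:
  assumes "uniform_rank (term_mat s l c \<alpha>)" "i < s" "j < l"
  shows "c i j \<noteq> 0"
proof -
  let ?A = "term_mat s l c \<alpha>"
  have A: "?A \<in> carrier_mat s l" by (simp add: term_mat_def)
  have "det (submatrix ?A {i} {j}) \<noteq> 0"
    using submatrix_in_minors[OF A, of "{i}" "{j}"] assms by (auto simp: uniform_rank_def)
  moreover have "submatrix ?A {i} {j} = mat 1 1 (\<lambda>_. Poly_Mapping.single (\<alpha> i j) (c i j))"
    using assms by (subst submatrix_eq_mat[OF A])
      (auto intro!: eq_matI simp: term_mat_def Least_equality)
  ultimately show ?thesis
    by (auto simp: det_single)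
qed

text \<open>
  Fix a variable. If its exponent in some row degree is 1, then its exponents in all column
  degrees are 1, because entries have nonnegative exponents; otherwise all row degrees have
  exponent 0. So its exponent in the entry \<open>(i, j)\<close> depends on \<open>i\<close> only or on \<open>j\<close> only.
\<close>

lemma squarefree_mat_decompose:
  fixes \<alpha> :: "nat \<Rightarrow> nat \<Rightarrow> ('n::finite) expo"
  assumes "squarefree_mat s l c \<alpha>" and c: "\<And>i j. i < s \<Longrightarrow> j < l \<Longrightarrow> c i j \<noteq> 0"
  obtains r m K where "\<And>i j. i < s \<Longrightarrow> j < l \<Longrightarrow> \<alpha> i j = r i + m j"
    and "\<And>i k. k \<notin> K \<Longrightarrow> Poly_Mapping.lookup (r i) k = 0"
    and "\<And>j k. k \<in> K \<Longrightarrow> Poly_Mapping.lookup (m j) k = 0"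
proof -
  obtain \<gamma> \<beta> where E: "solves_E s l c \<alpha> \<gamma> \<beta>"
    and \<gamma>: "\<And>j k. j < l \<Longrightarrow> \<gamma> j k \<in> {0, 1}" and \<beta>: "\<And>i k. i < s \<Longrightarrow> \<beta> i k \<in> {0, 1}"
    using assms(1) unfolding squarefree_mat_def by blast
  have \<alpha>: "int (Poly_Mapping.lookup (\<alpha> i j) k) = \<gamma> j k - \<beta> i k" if "i < s" "j < l" for i j k
    using E c that by (simp add: solves_E_def)
  \<comment> \<open>On \<open>K\<close> every column degree is forced to be 1, so the exponent
    \<gamma> - \<beta> becomes 1 - \<beta> and depends on the row only. Off \<open>K\<close> the row
    degree is 0 and only \<gamma> is left.\<close>
  define K where "K = {k. \<exists>i<s. \<beta> i k = 1}"
  define r where "r i = Abs_poly_mapping (\<lambda>k. if k \<in> K then nat (1 - \<beta> i k) else 0)" for i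
  define m where "m j = Abs_poly_mapping (\<lambda>k. if k \<in> K then 0 else nat (\<gamma> j k))" for j
  have r: "Poly_Mapping.lookup (r i) k = (if k \<in> K then nat (1 - \<beta> i k) else 0)" for i k
    unfolding r_def by (subst Abs_poly_mapping_inverse) simp_all
  have m: "Poly_Mapping.lookup (m j) k = (if k \<in> K then 0 else nat (\<gamma> j k))" for j k
    unfolding m_def by (subst Abs_poly_mapping_inverse) simp_all
  show thesis
  proof (rule that[of r m K])
    fix i j assume ij: "i < s" "j < l"
    show "\<alpha> i j = r i + m j"
    proof (rule poly_mapping_eqI)
      fix k
      show "Poly_Mapping.lookup (\<alpha> i j) k = Poly_Mapping.lookup (r i + m j) k"
      proof (cases "k \<in> K")
        case True
        then obtain i' where i': "i' < s" "\<beta> i' k = 1" by (auto simp: K_def)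
        then have "\<gamma> j k = 1"
          using \<alpha>[OF i'(1) ij(2), of k] \<gamma>[OF ij(2), of k] by auto
        then show ?thesis
          using True \<alpha>[OF ij, of k] by (simp add: lookup_add r m)
      next
        case False
        then have "\<beta> i k = 0"
          using \<beta>[OF ij(1), of k] ij by (auto simp: K_def)
        then show ?thesis
          using False \<alpha>[OF ij, of k] by (simp add: lookup_add r m)
      qed
    qed
  qed (simp_all add: r m)
qed

section \<open>Scalar matrices and the columns dividing a monomial\<close>

text \<open>By \<open>det_single_add\<close> the maximal minor on the columns \<open>J\<close> is a
  monomial times a scalar determinant. Uniform rank makes that determinant nonzero, so the scalar
  block is invertible over the field.\<close>

lemma maximal_minor_right_inverse:
  fixes c :: "nat \<Rightarrow> nat \<Rightarrow> 'k::field_char_0" and r m :: "nat \<Rightarrow> 'n expo"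
  assumes "uniform_rank (term_mat s l c \<alpha>)"
    and \<alpha>: "\<And>i j. i < s \<Longrightarrow> j < l \<Longrightarrow> \<alpha> i j = r i + m j"
    and J: "J \<subseteq> {..<l}" "card J = s" and "0 < s"
  obtains Z where "\<And>i i'. i < s \<Longrightarrow> i' < s \<Longrightarrow> (\<Sum>j\<in>J. c i' j * Z j i) = (if i' = i then 1 else 0)"
proof -
  let ?A = "term_mat s l c \<alpha>"
  let ?C = "mat s s (\<lambda>(p, q). c p (pick J q))"
  have A: "?A \<in> carrier_mat s l" by (simp add: term_mat_def)
  have "finite J" using J by (auto intro: finite_subset)
  then have bij: "bij_betw (pick J) {0..<s} J"
    using bij_betw_pick J by blast
  have pick_less: "pick J q < l" if "q < s" for q
    using bij_betw_apply[OF bij, of q] that J(1) by auto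
  have "submatrix ?A {..<s} J =
      mat s s (\<lambda>(p, q). Poly_Mapping.single (r p + m (pick J q)) (c p (pick J q)))"
    using J pick_less by (subst submatrix_eq_mat[OF A])
      (auto intro!: eq_matI simp: term_mat_def pick_lessThan \<alpha>)
  moreover have "det (submatrix ?A {..<s} J) \<noteq> 0"
    using submatrix_in_minors[OF A, of "{..<s}" J] J assms(1) \<open>0 < s\<close>
    by (auto simp: uniform_rank_def lessThan_empty_iff)
  ultimately have "det ?C \<noteq> 0"
    by (simp add: det_single_add[of s r "\<lambda>q. m (pick J q)"]) auto
  then have "?C \<in> Units (ring_mat TYPE('k) s ())"
    by (intro det_non_zero_imp_unit) auto
  then obtain D where D: "D \<in> carrier_mat s s" "?C * D = 1\<^sub>m s"
    by (auto simp: Units_def ring_mat_def)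
  \<comment> \<open>\<open>Z\<close> is the inverse matrix \<open>D\<close> with its rows relabelled
    by the columns in \<open>J\<close> that they belong to.\<close>
  define Z where "Z j i = D $$ (the_inv_into {0..<s} (pick J) j, i)" for j i
  show thesis
  proof (rule that[of Z])
    fix i i' assume i: "i < s" "i' < s"
    have "(\<Sum>j\<in>J. c i' j * Z j i) = (\<Sum>q = 0..<s. c i' (pick J q) * Z (pick J q) i)"
      by (rule sum.reindex_bij_betw[OF bij, symmetric])
    also have "\<dots> = (\<Sum>q = 0..<s. c i' (pick J q) * D $$ (q, i))"
      using bij by (intro sum.cong) (simp_all add: Z_def the_inv_into_f_f bij_betw_def)
    also have "\<dots> = (?C * D) $$ (i', i)"
      using D(1) i by (simp add: scalar_prod_def)
    finally show "(\<Sum>j\<in>J. c i' j * Z j i) = (if i' = i then 1 else 0)"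
      using D(2) i by simp
  qed
qed

text \<open>A rank bound by determinants: if \<open>T\<close> had fewer than \<open>s\<close>
  elements, both factors could be padded by zeros to square matrices of size \<open>s\<close>. Their
  product has determinant \<open>a ^ s\<close>, which is nonzero, while the padded second factor has
  a zero row.\<close>

lemma card_ge_of_scalar_factorization:
  fixes c :: "nat \<Rightarrow> nat \<Rightarrow> 'k::field"
  assumes "finite T" and "a \<noteq> 0"
    and CZ: "\<And>i i'. i < s \<Longrightarrow> i' < s \<Longrightarrow> (\<Sum>j\<in>T. c i' j * Z j i) = (if i' = i then a else 0)"
  shows "s \<le> card T"
proof (rule ccontr)
  assume "\<not> s \<le> card T"
  then have less: "card T < s" by simp
  let ?C = "mat s s (\<lambda>(p, q). if q < card T then c p (pick T q) else 0)"
  let ?Z = "mat s s (\<lambda>(p, q). if p < card T then Z (pick T p) q else 0)"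
  have "?C * ?Z = a \<cdot>\<^sub>m 1\<^sub>m s"
  proof (rule eq_matI)
    fix i' i assume "i' < dim_row (a \<cdot>\<^sub>m 1\<^sub>m s)" "i < dim_col (a \<cdot>\<^sub>m 1\<^sub>m s)"
    then have i: "i' < s" "i < s" by auto
    have "(?C * ?Z) $$ (i', i) =
        (\<Sum>q = 0..<s. if q < card T then c i' (pick T q) * Z (pick T q) i else 0)"
      using i by (auto simp: scalar_prod_def intro!: sum.cong)
    also have "\<dots> = (\<Sum>q = 0..<card T. c i' (pick T q) * Z (pick T q) i)"
      using less by (intro sum.mono_neutral_cong_right) auto
    also have "\<dots> = (\<Sum>j\<in>T. c i' j * Z j i)"
      by (rule sum.reindex_bij_betw[OF bij_betw_pick[OF \<open>finite T\<close>]])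
    finally show "(?C * ?Z) $$ (i', i) = (a \<cdot>\<^sub>m 1\<^sub>m s) $$ (i', i)"
      using CZ i by simp
  qed auto
  then have "det ?C * det ?Z = a ^ s"
    using det_mult[of ?C s ?Z] by (simp add: det_smult)
  moreover have "det ?Z = 0"
  proof -
    have "(\<Prod>p = 0..<s. ?Z $$ (p, \<pi> p)) = 0" if \<pi>: "\<pi> permutes {0..<s}" for \<pi>
    proof (rule prod_zero)
      \<comment> \<open>Row \<open>card T\<close> is the first padded row of \<open>?Z\<close> and
        puts a zero factor into every Leibniz product.\<close>
      have "\<pi> (card T) < s"
        using permutes_in_image[OF \<pi>, of "card T"] less by simp
      then show "\<exists>p\<in>{0..<s}. ?Z $$ (p, \<pi> p) = 0"
        using less by (intro bexI[of _ "card T"]) auto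
    qed simp
    then show ?thesis
      by (subst det_def'[of _ s]) (auto intro!: sum.neutral simp del: index_mat)
  qed
  ultimately show False
    using \<open>a \<noteq> 0\<close> by simp
qed

text \<open>
  The coefficients at \<open>\<beta>\<close> are compared after cancelling the row monomials, which makes them
  the entries of a product of matrices over the field.
\<close>

lemma scalar_annihilator_imp_columns:
  fixes c :: "nat \<Rightarrow> nat \<Rightarrow> 'k::field_char_0" and r m :: "nat \<Rightarrow> ('n::finite) expo"
  assumes \<alpha>: "\<And>i j. i < s \<Longrightarrow> j < l \<Longrightarrow> \<alpha> i j = r i + m j"
    and disj: "\<And>i k. k \<notin> K \<Longrightarrow> Poly_Mapping.lookup (r i) k = 0"
      "\<And>j k. k \<in> K \<Longrightarrow> Poly_Mapping.lookup (m j) k = 0"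
    and W: "W \<in> carrier_mat l s" "term_mat s l c \<alpha> * W = f \<cdot>\<^sub>m 1\<^sub>m s"
    and \<beta>: "\<beta> \<in> Poly_Mapping.keys f"
  obtains J where "J \<subseteq> {..<l}" "card J = s"
    "\<And>i j k. i < s \<Longrightarrow> j \<in> J \<Longrightarrow> Poly_Mapping.lookup (\<alpha> i j) k \<le> Poly_Mapping.lookup \<beta> k"
proof -
  \<comment> \<open>The column monomial stays with the entry of \<open>W\<close>; the row monomial
    is a common factor of row \<open>i'\<close> and can be split off.\<close>
  define P where "P i j = monomial (m j) * W $$ (j, i)" for i j
  have entry: "(\<Sum>j<l. Poly_Mapping.single 0 (c i' j) * P i j) * monomial (r i') =
      (if i' = i then f else 0)" if i: "i < s" "i' < s" for i i'
  proof -
    have "(term_mat s l c \<alpha> * W) $$ (i', i) =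
        (\<Sum>j<l. Poly_Mapping.single (r i' + m j) (c i' j) * W $$ (j, i))"
      using W(1) i by (simp add: term_mat_def scalar_prod_def \<alpha> atLeast0LessThan)
    also have "\<dots> = (\<Sum>j<l. Poly_Mapping.single 0 (c i' j) * P i j) * monomial (r i')"
      unfolding sum_distrib_right P_def
    proof (intro sum.cong refl)
      fix j
      have "(Poly_Mapping.single (r i' + m j) (c i' j) :: ('n, 'k) mpoly) =
          Poly_Mapping.single 0 (c i' j) * monomial (m j) * monomial (r i')"
        by (simp add: mult_single add.commute)
      then show "Poly_Mapping.single (r i' + m j) (c i' j) * W $$ (j, i) =
          Poly_Mapping.single 0 (c i' j) * (monomial (m j) * W $$ (j, i)) * monomial (r i')"
        by (simp only: mult_ac)
    qed
    finally show ?thesis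
      using i W(2) by (cases "i' = i") simp_all
  qed
  have coeff: "Poly_Mapping.lookup (if i' = i then f else 0) (r i' + \<delta>) =
      (\<Sum>j<l. c i' j * Poly_Mapping.lookup (P i j) \<delta>)" if i: "i < s" "i' < s" for i i' \<delta>
  proof -
    have "Poly_Mapping.lookup (Poly_Mapping.single 0 a * p) \<delta> = a * Poly_Mapping.lookup p \<delta>"
      for a :: 'k and p :: "('n, 'k) mpoly"
      by (simp add: map.rep_eq when_def flip: mult_map_scale_conv_mult)
    then show ?thesis
      unfolding entry[OF i, symmetric]
      by (simp add: mult.commute[of _ "monomial _"] lookup_monomial_mult lookup_sum)
  qed
  \<comment> \<open>The diagonal entry of the product is \<open>f\<close> itself, so the monomial of
    every row divides \<open>f\<close> and each of its terms.\<close>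
  have r_le: "\<exists>\<delta>. \<beta> = r i + \<delta>" if i: "i < s" for i
  proof -
    have "monomial (r i) dvd f"
      using entry[OF i i] by (metis dvd_triv_right)
    then show ?thesis
      using \<beta> by (simp add: monomial_dvd_iff expo_add_iff)
  qed
  define T where "T = {j. j < l \<and> (\<exists>\<delta>. \<beta> = m j + \<delta>)}"
  have "finite T" by (simp add: T_def)
  have "s \<le> card T"
  proof (rule card_ge_of_scalar_factorization[OF \<open>finite T\<close>])
    show "Poly_Mapping.lookup f \<beta> \<noteq> 0"
      using \<beta> by (simp add: in_keys_iff)
    fix i i' assume i: "i < s" "i' < s"
    \<comment> \<open>Column \<open>i\<close> of the product is read at \<beta> -
      \<open>r i\<close>. On the diagonal, restoring the row monomial gives \<beta> and hence the
      coefficient of \<open>f\<close> there; off the diagonal the entry is zero, whatever the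
      exponent.\<close>
    define \<delta> where "\<delta> i = \<beta> - r i" for i
    have \<delta>: "\<beta> = r i + \<delta> i" if "i < s" for i
      using r_le[OF that] by (auto simp: \<delta>_def)
    have "Poly_Mapping.lookup (P i j) (\<delta> i) = 0" if "j < l" "j \<notin> T" for j
    proof (rule ccontr)
      assume "Poly_Mapping.lookup (P i j) (\<delta> i) \<noteq> 0"
      then have "\<delta> i \<in> Poly_Mapping.keys (P i j)"
        by (simp add: in_keys_iff)
      then obtain \<epsilon> where "\<delta> i = m j + \<epsilon>"
        using keys_mult[of "monomial (m j)" "W $$ (j, i)"] by (auto simp: P_def)
      then have "\<beta> = m j + (r i + \<epsilon>)"
        using \<delta>[OF i(1)] by (simp add: ac_simps)
      with that show False by (auto simp: T_def)
    qed
    then have "(\<Sum>j\<in>T. c i' j * Poly_Mapping.lookup (P i j) (\<delta> i)) =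
        (\<Sum>j<l. c i' j * Poly_Mapping.lookup (P i j) (\<delta> i))"
      by (intro sum.mono_neutral_left) (auto simp: T_def)
    also have "\<dots> = (if i' = i then Poly_Mapping.lookup f \<beta> else 0)"
      using coeff[OF i, of "\<delta> i"] \<delta>[OF i(1)] by (auto split: if_splits)
    finally show "(\<Sum>j\<in>T. c i' j * Poly_Mapping.lookup (P i j) (\<beta> - r i)) =
        (if i' = i then Poly_Mapping.lookup f \<beta> else 0)"
      by (simp add: \<delta>_def)
  qed
  then obtain J where J: "J \<subseteq> T" "card J = s"
    by (meson obtain_subset_with_card_n)
  show thesis
  proof (rule that[of J])
    fix i j k assume i: "i < s" and j: "j \<in> J"
    then have "j < l" "\<exists>\<delta>. \<beta> = m j + \<delta>"
      using J by (auto simp: T_def)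
    \<comment> \<open>Row and column parts have disjoint supports, so divisibility by each of them
      gives divisibility by their product.\<close>
    then show "Poly_Mapping.lookup (\<alpha> i j) k \<le> Poly_Mapping.lookup \<beta> k"
      using r_le[OF i] disj(1)[of k i] disj(2)[of k j] i
      by (cases "k \<in> K") (simp_all add: \<alpha> expo_add_iff lookup_add)
  qed (use J in \<open>auto simp: T_def\<close>)
qed

text \<open>The inverse of the scalar block on \<open>J\<close>, with its entries multiplied by the
  quotients of x^\<beta> by the entries of \<open>A\<close>, yields the matrix \<open>W\<close> that
  \<open>mem_annihilator_coker_iff\<close> asks for.\<close>

lemma columns_imp_monomial_annihilates:
  fixes c :: "nat \<Rightarrow> nat \<Rightarrow> 'k::field_char_0" and r m :: "nat \<Rightarrow> 'n expo"
  assumes ur: "uniform_rank (term_mat s l c \<alpha>)"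
    and \<alpha>: "\<And>i j. i < s \<Longrightarrow> j < l \<Longrightarrow> \<alpha> i j = r i + m j"
    and J: "J \<subseteq> {..<l}" "card J = s" and "0 < s"
    and le: "\<And>i j k. i < s \<Longrightarrow> j \<in> J \<Longrightarrow> Poly_Mapping.lookup (\<alpha> i j) k \<le> Poly_Mapping.lookup \<beta> k"
  shows "monomial \<beta> \<in> annihilator type_ring (coker (term_mat s l c \<alpha>))"
proof -
  let ?A = "term_mat s l c \<alpha>"
  have A: "?A \<in> carrier_mat s l" by (simp add: term_mat_def)
  obtain Z where Z: "\<And>i i'. i < s \<Longrightarrow> i' < s \<Longrightarrow>
      (\<Sum>j\<in>J. c i' j * Z j i) = (if i' = i then 1 else 0)"
    using maximal_minor_right_inverse[OF ur \<alpha> J \<open>0 < s\<close>] by blast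
  \<comment> \<open>Subtraction of exponents is truncated, but \<open>le\<close> makes it exact for
    \<open>j\<close> in \<open>J\<close>.\<close>
  define W where "W = mat l s (\<lambda>(j, i). if j \<in> J then Poly_Mapping.single (\<beta> - \<alpha> i j) (Z j i) else 0)"
  obtain j\<^sub>0 where j\<^sub>0: "j\<^sub>0 \<in> J"
    using J \<open>0 < s\<close> by fastforce
  have "?A * W = monomial \<beta> \<cdot>\<^sub>m 1\<^sub>m s"
  proof (rule eq_matI)
    fix i' i assume "i' < dim_row (monomial \<beta> \<cdot>\<^sub>m 1\<^sub>m s :: ('n, 'k) mpoly mat)"
      "i < dim_col (monomial \<beta> \<cdot>\<^sub>m 1\<^sub>m s :: ('n, 'k) mpoly mat)"
    then have i: "i' < s" "i < s" by auto
    \<comment> \<open>The column degree cancels, leaving \<beta> + \<open>r i'\<close> -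
      \<open>r i\<close> for every column in \<open>J\<close>; \<open>j\<^sub>0\<close> only serves
      to name this common exponent. It can therefore be pulled out of the sum.\<close>
    define \<mu> where "\<mu> = \<alpha> i' j\<^sub>0 + (\<beta> - \<alpha> i j\<^sub>0)"
    have \<mu>: "\<alpha> i' j + (\<beta> - \<alpha> i j) = \<mu>" if "j \<in> J" for j
    proof (rule poly_mapping_eqI)
      fix k
      have "j < l" "j\<^sub>0 < l" using that j\<^sub>0 J by auto
      then show "Poly_Mapping.lookup (\<alpha> i' j + (\<beta> - \<alpha> i j)) k = Poly_Mapping.lookup \<mu> k"
        using le[OF i(2) that, of k] le[OF i(2) j\<^sub>0, of k] i
        by (simp add: \<mu>_def \<alpha> lookup_add lookup_minus)
    qed
    have "\<mu> = \<beta>" if "i' = i"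
      using that le[OF i(2) j\<^sub>0]
      by (intro poly_mapping_eqI) (simp add: \<mu>_def lookup_add lookup_minus)
    have "(?A * W) $$ (i', i) = (\<Sum>j<l. if j \<in> J then Poly_Mapping.single \<mu> (c i' j * Z j i) else 0)"
      using i by (auto simp: term_mat_def W_def scalar_prod_def mult_single atLeast0LessThan \<mu>
          intro!: sum.cong)
    also have "\<dots> = Poly_Mapping.single \<mu> (\<Sum>j\<in>J. c i' j * Z j i)"
      using J by (simp add: single_sum sum.If_cases Int_absorb1 flip: sum.inter_restrict)
    finally show "(?A * W) $$ (i', i) = (monomial \<beta> \<cdot>\<^sub>m 1\<^sub>m s) $$ (i', i)"
      using i Z[OF i(2) i(1)] \<open>i' = i \<Longrightarrow> \<mu> = \<beta>\<close> by auto
  qed (auto simp: term_mat_def W_def)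
  then show ?thesis
    unfolding mem_annihilator_coker_iff[OF A] by (auto simp: W_def)
qed

theorem proposition3p9:
  fixes s l :: nat
    and c :: "nat \<Rightarrow> nat \<Rightarrow> 'k::field_char_0"
    and \<alpha> :: "nat \<Rightarrow> nat \<Rightarrow> ('n::finite) expo"
  defines "A \<equiv> term_mat s l c \<alpha>"
  assumes "multigraded A"
    and "squarefree_mat s l c \<alpha>"
    and "uniform_rank A"
    and "s \<le> l"
  shows "annihilator type_ring (coker A) = (\<Inter>i<s. row_ideal s l \<alpha> i)"
proof (cases "s = 0")
  \<comment> \<open>The cokernel is zero and the intersection is over an empty family, so both sides
    are the whole ring.\<close>
  case True
  have A: "A \<in> carrier_mat s l" by (simp add: A_def term_mat_def)
  have "f \<in> annihilator type_ring (coker A)" for f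
    unfolding mem_annihilator_coker_iff[OF A] using A True
    by (intro bexI[of _ "0\<^sub>m l s"] eq_matI) auto
  with True show ?thesis by auto
next
  case False
  then have "0 < s" by simp
  have A: "A \<in> carrier_mat s l" by (simp add: A_def term_mat_def)
  note ur = \<open>uniform_rank A\<close>[unfolded A_def]
  obtain r m K where \<alpha>: "\<And>i j. i < s \<Longrightarrow> j < l \<Longrightarrow> \<alpha> i j = r i + m j"
    and disj: "\<And>i k. k \<notin> K \<Longrightarrow> Poly_Mapping.lookup (r i) k = 0"
      "\<And>j k. k \<in> K \<Longrightarrow> Poly_Mapping.lookup (m j) k = 0"
    using squarefree_mat_decompose[OF \<open>squarefree_mat s l c \<alpha>\<close> uniform_rank_coeff_nonzero[OF ur]]
    by metis
  show ?thesis
  proof (intro subset_antisym subsetI INT_I)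
    fix f i assume f: "f \<in> annihilator type_ring (coker A)" and "i \<in> {..<s}"
    then have i: "i < s" by simp
    obtain W where W: "W \<in> carrier_mat l s" "term_mat s l c \<alpha> * W = f \<cdot>\<^sub>m 1\<^sub>m s"
      using f mem_annihilator_coker_iff[OF A] by (auto simp: A_def)
    show "f \<in> row_ideal s l \<alpha> i"
      unfolding mem_row_ideal_iff[OF i]
    proof
      fix \<beta> assume "\<beta> \<in> Poly_Mapping.keys f"
      then obtain J where J: "J \<subseteq> {..<l}" "card J = s"
        "\<And>i j k. i < s \<Longrightarrow> j \<in> J \<Longrightarrow> Poly_Mapping.lookup (\<alpha> i j) k \<le> Poly_Mapping.lookup \<beta> k"
        using scalar_annihilator_imp_columns[OF \<alpha> disj W] by metis
      \<comment> \<open>Row \<open>i\<close> asks for \<open>s - i\<close> columns only, so any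
        subset of that size of the \<open>s\<close> common columns will do.\<close>
      obtain J' where "J' \<subseteq> J" "card J' = s - i"
        using J(2) by (metis diff_le_self obtain_subset_with_card_n)
      then show "\<exists>J\<subseteq>{..<l}. card J = s - i \<and>
          (\<forall>j\<in>J. \<forall>k. Poly_Mapping.lookup (\<alpha> i j) k \<le> Poly_Mapping.lookup \<beta> k)"
        using J i by (intro exI[of _ J']) auto
    qed
  next
    fix f :: "('n, 'k) mpoly" assume f: "f \<in> (\<Inter>i<s. row_ideal s l \<alpha> i)"
    note ann = ideal_annihilator_coker[of A]
    have "Poly_Mapping.single \<beta> (Poly_Mapping.lookup f \<beta>) \<in> annihilator type_ring (coker A)"
      if \<beta>: "\<beta> \<in> Poly_Mapping.keys f" for \<beta>
    proof -
      have "\<exists>J\<subseteq>{..<l}. card J = s - i \<and>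
          (\<forall>j\<in>J. \<forall>k. Poly_Mapping.lookup (\<alpha> i j) k \<le> Poly_Mapping.lookup \<beta> k)" if "i < s" for i
        using f \<beta> mem_row_ideal_iff[OF that, of f l \<alpha>] that by blast
      then obtain J where J: "\<And>i. i < s \<Longrightarrow> J i \<subseteq> {..<l}" "\<And>i. i < s \<Longrightarrow> card (J i) = s - i"
        "\<And>i j k. i < s \<Longrightarrow> j \<in> J i \<Longrightarrow> Poly_Mapping.lookup (\<alpha> i j) k \<le> Poly_Mapping.lookup \<beta> k"
        by metis
      \<comment> \<open>The \<open>s\<close> columns found for row 0 serve all rows. In a variable
        from \<open>K\<close> the exponent depends on the row only, and any member of the nonempty
        set \<open>J i\<close> bounds it. In the other variables it depends on the column only, and
        row 0 bounds it.\<close>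
      have "Poly_Mapping.lookup (\<alpha> i j) k \<le> Poly_Mapping.lookup \<beta> k"
        if i: "i < s" and j: "j \<in> J 0" for i j k
      proof (cases "k \<in> K")
        case True
        obtain j' where j': "j' \<in> J i"
          using J(2)[OF i] i by fastforce
        then have "j < l" "j' < l"
          using J(1) \<open>0 < s\<close> i j by blast+
        then show ?thesis
          using J(3)[OF i j', of k] disj(2)[OF True] i by (simp add: \<alpha> lookup_add)
      next
        case False
        have "j < l"
          using J(1) \<open>0 < s\<close> j by blast
        then show ?thesis
          using J(3)[OF \<open>0 < s\<close> j, of k] disj(1)[OF False] i \<open>0 < s\<close> by (simp add: \<alpha> lookup_add)
      qed
      then have "monomial \<beta> \<in> annihilator type_ring (coker A)"
        using columns_imp_monomial_annihilates[OF ur \<alpha>, of "J 0" \<beta>] J(1,2)[OF \<open>0 < s\<close>] \<open>0 < s\<close>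
        by (simp add: A_def)
      then have "Poly_Mapping.single 0 (Poly_Mapping.lookup f \<beta>) * monomial \<beta>
          \<in> annihilator type_ring (coker A)"
        by (rule ideal_type_ring_closed[OF ann])
      then show ?thesis
        by (simp add: mult_single)
    qed
    then have "(\<Sum>\<beta>\<in>Poly_Mapping.keys f. Poly_Mapping.single \<beta> (Poly_Mapping.lookup f \<beta>))
        \<in> annihilator type_ring (coker A)"
      by (rule ideal_type_ring_sum[OF ann])
    then show "f \<in> annihilator type_ring (coker A)"
      by (simp add: sum_single_lookup)
  qed
qed

end
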